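(* (a) There are functions $\varphi:\mathbb{D}\to[0,\infty)$ such that $\varphi^H\in L^1_w(\partial\mathbb{D})$, but that do not admit a positive harmonic majorant. (b) There are functions $\varphi:\mathbb{D}\to[0,\infty)$ such that $M\varphi\in L^1_w(\partial\mathbb{D})$, but $\varphi^H\notin L^1_w(\partial\mathbb{D})$.
   Context: $\mathbb{D}$ is the open unit disc, $\sigma$ is normalized Lebesgue measure on $\partial\mathbb{D}$; functions $\varphi$ are Borel measurable. Fix an aperture $\alpha\ge1$; the Stolz angle at $\zeta\in\partial\mathbb{D}$ is $\Gamma(\zeta)=\{z\in\mathbb{D}:|z-\zeta|\le\alpha(1-|z|^2)\}$, and $I_z=\{\zeta\in\partial\mathbb{D}:z\in\Gamma(\zeta)\}$ for $z\in\mathbb{D}$. Put $M\varphi(\zeta)=\sup_{\Gamma(\zeta)}\varphi$ and $\varphi^H(\zeta)=\sup_{z\in\mathbb{D}}\varphi(z)\chi_{I_z}^*(\zeta)$, where for a nonnegative $u$ on $\partial\mathbb{D}$, $u^*(x)=\sup_{I\ni x}\frac1{\sigma(I)}\int_I u\,d\sigma$ (supremum over arcs $I$ containing $x$) is the Hardy–Littlewood maximal function. $L^1_w(\partial\mathbb{D})$ is the set of measurable $f$ with $\sup_{t>0}t\,\sigma\{\zeta:|f(\zeta)|>t\}<\infty$. A positive harmonic majorant of $\varphi$ is a harmonic function $h\ge0$ on $\mathbb{D}$ with $h\ge\varphi$ on $\mathbb{D}$. *)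

theory Defs
  imports "HOL-Analysis.Analysis"
begin

definition unit_disc :: "complex set" where
  "unit_disc = ball 0 1"

definition unit_circle :: "complex set" where
  "unit_circle = sphere 0 1"

definition circle_measure :: "complex measure" where
  "circle_measure =
     distr (uniform_measure lborel {0..2 * pi}) (restrict_space borel unit_circle) cis"

definition stolz_angle :: "real \<Rightarrow> complex \<Rightarrow> complex set" where
  "stolz_angle \<alpha> \<zeta> = {z \<in> unit_disc. cmod (z - \<zeta>) \<le> \<alpha> * (1 - (cmod z)\<^sup>2)}"

definition shadow :: "real \<Rightarrow> complex \<Rightarrow> complex set" where
  "shadow \<alpha> z = {\<zeta> \<in> unit_circle. z \<in> stolz_angle \<alpha> \<zeta>}"

text \<open>
  Nondegenerate arcs of the circle, with or without their endpoints. The case of length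
  \<open>2 * pi\<close> gives the whole circle and the circle minus one point.
\<close>

definition circle_arc :: "complex set \<Rightarrow> bool" where
  "circle_arc I \<longleftrightarrow>
     (\<exists>a b. a < b \<and> b \<le> a + 2 * pi \<and> cis ` {a<..<b} \<subseteq> I \<and> I \<subseteq> cis ` {a..b})"

definition hl_maximal :: "(complex \<Rightarrow> ennreal) \<Rightarrow> complex \<Rightarrow> ennreal" where
  "hl_maximal u x =
     (SUP I \<in> {I. circle_arc I \<and> x \<in> I}.
        (\<integral>\<^sup>+\<zeta>\<in>I. u \<zeta> \<partial>circle_measure) / emeasure circle_measure I)"

text \<open>
  The two maximal functions of a function on the disc may take the value \<open>\<infinity>\<close>, hence
  the codomain \<^typ>\<open>ennreal\<close>. Only values of \<open>\<phi>\<close> on the disc, where \<open>\<phi>\<close> is assumed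
  nonnegative, are used.
\<close>

definition stolz_maximal :: "real \<Rightarrow> (complex \<Rightarrow> real) \<Rightarrow> complex \<Rightarrow> ennreal" where
  "stolz_maximal \<alpha> \<phi> \<zeta> = (SUP z \<in> stolz_angle \<alpha> \<zeta>. ennreal (\<phi> z))"

definition hl_stolz_maximal :: "real \<Rightarrow> (complex \<Rightarrow> real) \<Rightarrow> complex \<Rightarrow> ennreal" where
  "hl_stolz_maximal \<alpha> \<phi> \<zeta> =
     (SUP z \<in> unit_disc. ennreal (\<phi> z) * hl_maximal (indicator (shadow \<alpha> z)) \<zeta>)"

text \<open>The nonnegative part of weak \<open>L\<^sup>1\<close>, so that no absolute value is needed.\<close>

definition weak_L1 :: "(complex \<Rightarrow> ennreal) set" where
  "weak_L1 = {f \<in> borel_measurable circle_measure.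
     (SUP t \<in> {0::real<..}.
        ennreal t * emeasure circle_measure {\<zeta> \<in> unit_circle. f \<zeta> > ennreal t}) < \<infinity>}"

text \<open>
  A function is harmonic on an open set if it is twice continuously differentiable there
  and its Laplacian vanishes; \<open>h'\<close> and \<open>h''\<close> are the first and second Frechet
  derivatives over the reals.
\<close>

definition harmonic_fun_on :: "(complex \<Rightarrow> real) \<Rightarrow> complex set \<Rightarrow> bool" where
  "harmonic_fun_on h S \<longleftrightarrow>
     (\<exists>(h' :: complex \<Rightarrow> complex \<Rightarrow>\<^sub>L real) (h'' :: complex \<Rightarrow> complex \<Rightarrow>\<^sub>L complex \<Rightarrow>\<^sub>L real).
        (\<forall>z\<in>S. (h has_derivative blinfun_apply (h' z)) (at z)) \<and>
        (\<forall>z\<in>S. (h' has_derivative blinfun_apply (h'' z)) (at z)) \<and>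
        continuous_on S h'' \<and>
        (\<forall>z\<in>S. blinfun_apply (blinfun_apply (h'' z) 1) 1
              + blinfun_apply (blinfun_apply (h'' z) \<i>) \<i> = 0))"

definition positive_harmonic_majorant :: "(complex \<Rightarrow> real) \<Rightarrow> (complex \<Rightarrow> real) \<Rightarrow> bool" where
  "positive_harmonic_majorant h \<phi> \<longleftrightarrow>
     harmonic_fun_on h unit_disc \<and> (\<forall>z\<in>unit_disc. 0 \<le> h z \<and> \<phi> z \<le> h z)"

definition nonneg_borel_on_disc :: "(complex \<Rightarrow> real) \<Rightarrow> bool" where
  "nonneg_borel_on_disc \<phi> \<longleftrightarrow>
     \<phi> \<in> borel_measurable (restrict_space borel unit_disc) \<and> (\<forall>z\<in>unit_disc. 0 \<le> \<phi> z)"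

end

(*
  (a) Take phi(z) = 1 / |z - 1|. Since 1 - |z| <= |z - 1| and the maximal function of the
  indicator of I_z decays like (1 - |z|) / |zeta - z|, the function phi^H is dominated by a multiple
  of 1 / |zeta - 1|, which is in weak L^1. A harmonic majorant h would satisfy the mean value
  property on circles of radius r < 1, but the mean of phi over such a circle is at least of
  order log (1 / (1 - r)), hence unbounded.

  (b) Put phi = 2^j at the points z_j = (1 - 2^-j) exp(i sqrt j) and phi = 0 elsewhere. The set
  M phi > t is a union of arcs of length about 2^-j with 2^j > t, so its measure is O(1/t). On the
  other hand phi^H is at least of order 1 / (2^-j + |zeta - exp(i sqrt j)|) for all j, and every tail
  of exp(i sqrt j) is dense in the circle, so phi^H is identically infinite.
*)
theory Submission
  imports Defs "HOL-Probability.Probability_Measure"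
begin

section \<open>Arc length on the unit circle\<close>

lemma space_circle_measure [simp]: "space circle_measure = unit_circle"
  by (simp add: circle_measure_def space_restrict_space)

lemma sets_circle_measure: "sets circle_measure = {A \<in> sets borel. A \<subseteq> unit_circle}"
proof -
  have "unit_circle \<in> sets borel" by (simp add: unit_circle_def)
  then show ?thesis
    by (auto simp: circle_measure_def sets_restrict_space_iff)
qed

lemma cis_in_unit_circle [simp]: "cis x \<in> unit_circle"
  by (simp add: unit_circle_def)

text \<open>The base point \<open>a\<close> is left free: a window centred at a known argument keeps
  differences within \<pi>, and a window far out on the real line supplies the large arguments that
  the spiral only reaches late.\<close>

lemma unit_circle_cis_near:
  assumes "\<zeta> \<in> unit_circle"
  obtains x where "\<zeta> = cis x" "a \<le> x" "x < a + 2 * pi"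
proof -
  define t where "t = Arg \<zeta>"
  have t: "\<zeta> = cis t"
    using assms cis_Arg[of \<zeta>] by (cases "\<zeta> = 0") (auto simp: t_def unit_circle_def sgn_div_norm)
  define k where "k = \<lfloor>(t - a) / (2 * pi)\<rfloor>"
  have k: "of_int k \<le> (t - a) / (2 * pi)" "(t - a) / (2 * pi) < of_int k + 1"
    unfolding k_def by linarith+
  have "\<zeta> = cis (t - 2 * pi * of_int k)"
    by (simp add: t flip: cis_divide)
  moreover have "a \<le> t - 2 * pi * of_int k" "t - 2 * pi * of_int k < a + 2 * pi"
    using k by (simp_all add: field_simps)
  ultimately show ?thesis by (rule that)
qed

lemma borel_measurable_cis: "cis \<in> borel_measurable borel"
  by (intro borel_measurable_continuous_onI continuous_intros)

lemma cis_measurable: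
  "cis \<in> measurable (uniform_measure lborel {0..2 * pi}) (restrict_space borel unit_circle)"
  using borel_measurable_cis by (intro measurable_restrict_space2) (auto simp: measurable_def)

lemma prob_space_circle_measure: "prob_space circle_measure"
  unfolding circle_measure_def
  by (intro prob_space.prob_space_distr prob_space_uniform_measure cis_measurable) auto

interpretation circle: prob_space circle_measure
  by (rule prob_space_circle_measure)

section \<open>Circle measure as Lebesgue measure on one period\<close>

lemma emeasure_lborel_translate:
  fixes S :: "real set"
  assumes "S \<in> sets borel"
  shows "emeasure lborel ((+) c -` S) = emeasure lborel S"
proof -
  have "emeasure lborel S = emeasure (distr lborel borel ((+) c)) S"
    by (simp add: lborel_distr_plus)
  also have "\<dots> = emeasure lborel ((+) c -` S)"
    using assms by (subst emeasure_distr) auto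
  finally show ?thesis ..
qed

text \<open>Cut the window at \<open>c + p\<close>, the first multiple of \<open>p\<close> beyond
  \<open>a\<close>, and move the right piece back by \<open>p\<close>. The pieces then fill
  \<open>{c..<c + p}\<close>, a translate of \<open>{0..<p}\<close> by a multiple of
  \<open>p\<close>.\<close>

lemma emeasure_lborel_period:
  assumes [measurable]: "P \<in> sets (borel :: real measure)" and "p > 0"
    and P: "\<And>x. x + p \<in> P \<longleftrightarrow> x \<in> P"
  shows "emeasure lborel ({a..<a + p} \<inter> P) = emeasure lborel ({0..<p} \<inter> P)"
proof -
  have P_nat: "x + of_nat k * p \<in> P \<longleftrightarrow> x \<in> P" for x k
  proof (induction k)
    case (Suc k)
    then show ?case using P[of "x + of_nat k * p"] by (simp add: distrib_right add_ac)
  qed simp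
  have P_int: "of_int k * p + x \<in> P \<longleftrightarrow> x \<in> P" for x k
  proof (cases "k \<ge> 0")
    case True
    then show ?thesis using P_nat[of x "nat k"] by (simp add: add.commute)
  next
    case False
    then show ?thesis using P_nat[of "of_int k * p + x" "nat (- k)"] by (simp add: algebra_simps)
  qed
  have shift: "emeasure lborel ({u + of_int k * p..<v + of_int k * p} \<inter> P) = emeasure lborel ({u..<v} \<inter> P)"
    for u v k
  proof -
    have "(+) (of_int k * p) -` ({u + of_int k * p..<v + of_int k * p} \<inter> P) = {u..<v} \<inter> P"
      using P_int by auto
    then show ?thesis
      using emeasure_lborel_translate[of "{u + of_int k * p..<v + of_int k * p} \<inter> P" "of_int k * p"]
      by simp
  qed
  define k where "k = \<lfloor>a / p\<rfloor>"
  define c where "c = of_int k * p"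
  have c: "c \<le> a" "a < c + p"
    unfolding c_def k_def using \<open>p > 0\<close> floor_divide_lower[of p a] floor_divide_upper[of p a]
    by (simp_all add: algebra_simps)
  have split: "emeasure lborel ({u..<w} \<inter> P) = emeasure lborel ({u..<v} \<inter> P) + emeasure lborel ({v..<w} \<inter> P)"
    if "u \<le> v" "v \<le> w" for u v w
    using that by (subst plus_emeasure) (auto intro!: arg_cong[where f = "emeasure lborel"])
  have "emeasure lborel ({a..<a + p} \<inter> P)
      = emeasure lborel ({a..<c + p} \<inter> P) + emeasure lborel ({c + p..<a + p} \<inter> P)"
    using c by (intro split) auto
  also have "emeasure lborel ({c + p..<a + p} \<inter> P) = emeasure lborel ({c..<a} \<inter> P)"
    using shift[of c 1 a] by simp
  also have "emeasure lborel ({a..<c + p} \<inter> P) + emeasure lborel ({c..<a} \<inter> P)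
      = emeasure lborel ({c..<c + p} \<inter> P)"
    using c by (subst split[of c a "c + p"]) (auto simp: add.commute)
  also have "\<dots> = emeasure lborel ({0..<p} \<inter> P)"
    using shift[of 0 k p] by (simp add: c_def add.commute)
  finally show ?thesis .
qed

text \<open>Since \<open>a\<close> is arbitrary, each later estimate can choose a window that suits
  the set being measured.\<close>

lemma emeasure_circle_measure:
  assumes A: "A \<in> sets circle_measure"
  shows "emeasure circle_measure A = emeasure lborel ({a..<a + 2 * pi} \<inter> cis -` A) / ennreal (2 * pi)"
proof -
  have pre [measurable]: "cis -` A \<in> sets borel"
    using measurable_sets[OF borel_measurable_cis, of A] A by (simp add: sets_circle_measure)
  have "emeasure circle_measure A = emeasure (uniform_measure lborel {0..2 * pi}) (cis -` A)"
    unfolding circle_measure_def using A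
    by (subst emeasure_distr) (auto intro: cis_measurable simp: circle_measure_def)
  also have "\<dots> = emeasure lborel ({0..2 * pi} \<inter> cis -` A) / ennreal (2 * pi)"
    by (subst emeasure_uniform_measure) auto
  \<comment> \<open>The endpoint \<open>2 * pi\<close> is a null set; dropping it leaves exactly one
    period.\<close>
  also have "emeasure lborel ({0..2 * pi} \<inter> cis -` A) = emeasure lborel ({0..<2 * pi} \<inter> cis -` A)"
  proof (rule emeasure_eq_AE)
    have "AE x in lborel. x \<noteq> 2 * pi"
      by (rule AE_lborel_singleton)
    then show "AE x in lborel. (x \<in> {0..2 * pi} \<inter> cis -` A) = (x \<in> {0..<2 * pi} \<inter> cis -` A)"
      by eventually_elim auto
  qed auto
  also have "\<dots> = emeasure lborel ({a..<a + 2 * pi} \<inter> cis -` A)"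
    by (rule emeasure_lborel_period[symmetric]) (auto simp flip: cis_mult)
  finally show ?thesis .
qed

lemma measure_circle_measure_le:
  assumes A: "A \<in> sets circle_measure" and "0 \<le> l"
    and sub: "\<And>x. a \<le> x \<Longrightarrow> x < a + 2 * pi \<Longrightarrow> cis x \<in> A \<Longrightarrow> x \<in> {u..u + l}"
  shows "measure circle_measure A \<le> l / (2 * pi)"
proof -
  have "emeasure lborel ({a..<a + 2 * pi} \<inter> cis -` A) \<le> emeasure lborel {u..u + l}"
    using sub by (intro emeasure_mono) auto
  then have "emeasure circle_measure A \<le> ennreal l / ennreal (2 * pi)"
    using \<open>0 \<le> l\<close> by (subst emeasure_circle_measure[OF A, of a]) (auto intro!: divide_right_mono_ennreal)
  then show ?thesis
    using \<open>0 \<le> l\<close> by (simp add: circle.emeasure_eq_measure divide_ennreal)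
qed

lemma measure_circle_measure_ge:
  assumes A: "A \<in> sets circle_measure" and "0 \<le> l" "l \<le> 2 * pi"
    and sub: "\<And>x. a < x \<Longrightarrow> x < a + l \<Longrightarrow> cis x \<in> A"
  shows "l / (2 * pi) \<le> measure circle_measure A"
proof -
  have [measurable]: "cis -` A \<in> sets borel"
    using measurable_sets[OF borel_measurable_cis, of A] A by (simp add: sets_circle_measure)
  have "emeasure lborel {a<..<a + l} \<le> emeasure lborel ({a..<a + 2 * pi} \<inter> cis -` A)"
    using sub assms by (intro emeasure_mono) auto
  then have "ennreal l / ennreal (2 * pi) \<le> emeasure circle_measure A"
    using \<open>0 \<le> l\<close> by (subst emeasure_circle_measure[OF A, of a]) (auto intro!: divide_right_mono_ennreal)
  then show ?thesis
    using \<open>0 \<le> l\<close> by (simp add: circle.emeasure_eq_measure divide_ennreal)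
qed

section \<open>Chord length against arc length\<close>

lemma cmod_cis_diff: "cmod (cis x - cis y) = 2 * \<bar>sin ((x - y) / 2)\<bar>"
proof -
  have "cis x - cis y = cis y * (exp (\<i> * of_real (x - y)) - 1)"
    by (simp add: cis_conv_exp algebra_simps flip: exp_add)
  then show ?thesis
    by (simp add: norm_mult dist_exp_i_1 del: of_real_diff)
qed

lemma cmod_cis_diff_le: "cmod (cis x - cis y) \<le> \<bar>x - y\<bar>"
  using abs_sin_x_le_abs_x[of "(x - y) / 2"] by (simp add: cmod_cis_diff)

text \<open>On [0, \<pi>/4] the derivative of sine is at least cos(\<pi>/4), so sin(t/2) is at least
  cos(\<pi>/4) t/2. The double angle formula brings in a second factor cos(\<pi>/4), and the two
  together give 1/2.\<close>

lemma sin_ge_half: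
  fixes t :: real
  assumes "0 \<le> t" "t \<le> pi / 2"
  shows "t / 2 \<le> sin t"
proof -
  have cos4: "cos (pi / 4) \<le> cos s" if "0 \<le> s" "s \<le> t / 2" for s
    using that assms by (intro cos_monotone_0_pi_le) auto
  have "sin 0 - cos (pi / 4) * 0 \<le> sin (t / 2) - cos (pi / 4) * (t / 2)"
    using assms cos4
    by (intro DERIV_nonneg_imp_nondecreasing[where f = "\<lambda>s. sin s - cos (pi / 4) * s"])
       (auto intro!: derivative_eq_intros)
  then have "cos (pi / 4) * (t / 2) \<le> sin (t / 2)" by simp
  then have "cos (pi / 4) * (t / 2) * cos (pi / 4) \<le> sin (t / 2) * cos (t / 2)"
    using cos4[of "t / 2"] assms by (intro mult_mono) (auto intro!: sin_ge_zero simp: cos_45)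
  moreover have "cos (pi / 4) * (t / 2) * cos (pi / 4) = t / 4"
    by (simp add: cos_45 field_simps)
  moreover have "sin t = 2 * sin (t / 2) * cos (t / 2)"
    using sin_double[of "t / 2"] by simp
  ultimately show ?thesis
    by linarith
qed

lemma cmod_cis_diff_ge:
  assumes "\<bar>x - y\<bar> \<le> pi"
  shows "\<bar>x - y\<bar> / 2 \<le> cmod (cis x - cis y)"
proof -
  have "\<bar>sin ((x - y) / 2)\<bar> = sin (\<bar>x - y\<bar> / 2)"
  proof (cases "x \<le> y")
    case True
    have "sin ((x - y) / 2) = - sin ((y - x) / 2)"
      by (metis sin_minus minus_diff_eq minus_divide_left)
    then show ?thesis using True assms sin_ge_zero[of "(y - x) / 2"] by simp
  qed (use assms sin_ge_zero[of "(x - y) / 2"] in simp)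
  moreover have "\<bar>x - y\<bar> / 2 / 2 \<le> sin (\<bar>x - y\<bar> / 2)"
    using assms by (intro sin_ge_half) auto
  ultimately show ?thesis by (simp add: cmod_cis_diff)
qed

text \<open>In the window centred at the argument \<open>y\<close> of one point of \<open>A\<close>,
  chords are at least half the arcs, so all arguments of \<open>A\<close> lie within
  \<open>2 * D\<close> of \<open>y\<close>. Normalizing the length \<open>4 * D\<close> leaves less
  than \<open>2 * D\<close> when \<open>D\<close> is positive.\<close>

lemma measure_circle_diameter_le:
  assumes A: "A \<in> sets circle_measure"
    and diam: "\<And>\<zeta> \<xi>. \<zeta> \<in> A \<Longrightarrow> \<xi> \<in> A \<Longrightarrow> cmod (\<zeta> - \<xi>) \<le> D" and "0 \<le> D"
  shows "measure circle_measure A \<le> 2 * D"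
proof (cases "A = {}")
  case False
  then obtain \<xi> where \<xi>: "\<xi> \<in> A" by auto
  then have "\<xi> \<in> unit_circle" using A by (auto simp: sets_circle_measure)
  then obtain y where y: "\<xi> = cis y" by (rule unit_circle_cis_near)
  have "measure circle_measure A \<le> (4 * D) / (2 * pi)"
  proof (rule measure_circle_measure_le[OF A, where a = "y - pi" and u = "y - 2 * D"])
    fix x assume x: "y - pi \<le> x" "x < y - pi + 2 * pi" "cis x \<in> A"
    then have "\<bar>x - y\<bar> / 2 \<le> cmod (cis x - cis y)"
      by (intro cmod_cis_diff_ge) auto
    also have "\<dots> \<le> D" using diam x \<xi> y by auto
    finally show "x \<in> {y - 2 * D..y - 2 * D + 4 * D}" by (auto simp: abs_if split: if_splits)
  qed (use \<open>0 \<le> D\<close> in auto)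
  also have "\<dots> \<le> 2 * D"
    using \<open>0 \<le> D\<close> pi_gt3 mult_right_mono[of 1 pi D] by (simp add: field_simps)
  finally show ?thesis .
qed (use \<open>0 \<le> D\<close> in simp)

section \<open>Arcs and averages over them\<close>

lemma circle_arcE:
  assumes "circle_arc I"
  obtains a b where "a < b" "b \<le> a + 2 * pi" "cis ` {a<..<b} \<subseteq> I" "I \<subseteq> cis ` {a..b}"
    "I \<in> sets circle_measure" "(b - a) / (2 * pi) \<le> measure circle_measure I"
proof -
  obtain a b where ab: "a < b" "b \<le> a + 2 * pi" "cis ` {a<..<b} \<subseteq> I" "I \<subseteq> cis ` {a..b}"
    using assms by (auto simp: circle_arc_def)
  have "closed (cis ` {a..b})"
    by (intro compact_imp_closed compact_continuous_image continuous_intros) auto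
  then have 1: "cis ` {a..b} \<in> sets borel" by simp
  \<comment> \<open>\<open>I\<close> differs from a closed arc by at most the two endpoints, and is
    therefore Borel.\<close>
  define F where "F = cis ` {a..b} - I"
  have "F \<subseteq> {cis a, cis b}"
  proof
    fix z assume "z \<in> F"
    then obtain x where x: "z = cis x" "a \<le> x" "x \<le> b" "z \<notin> I" by (auto simp: F_def)
    with ab(3) have "\<not> (a < x \<and> x < b)" by (auto simp: image_subset_iff)
    with x show "z \<in> {cis a, cis b}" by auto
  qed
  then have "finite F" by (rule finite_subset) auto
  then have "F \<in> sets borel" by (simp add: finite_imp_closed)
  moreover have "I = cis ` {a..b} - F" using ab by (auto simp: F_def)
  ultimately have "I \<in> sets borel" using 1 by auto
  then have I: "I \<in> sets circle_measure"
    using ab(4) by (auto simp: sets_circle_measure)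
  have "(b - a) / (2 * pi) \<le> measure circle_measure I"
    using ab by (intro measure_circle_measure_ge[OF I, where a = a]) auto
  with ab I show ?thesis by (rule that)
qed

lemma circle_arc_measurable: "circle_arc I \<Longrightarrow> I \<in> sets circle_measure"
  by (erule circle_arcE)

text \<open>Nondegenerate arcs have positive measure, so the quotient in \<open>ennreal\<close>
  never divides by zero and becomes a quotient of reals.\<close>

lemma hl_maximal_indicator:
  assumes "S \<in> sets circle_measure"
  shows "hl_maximal (indicator S) \<zeta> =
    (SUP I \<in> {I. circle_arc I \<and> \<zeta> \<in> I}.
      ennreal (measure circle_measure (S \<inter> I) / measure circle_measure I))"
  unfolding hl_maximal_def
proof (rule SUP_cong[OF refl])
  fix I assume "I \<in> {I. circle_arc I \<and> \<zeta> \<in> I}"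
  then obtain a b where I: "a < b" "I \<in> sets circle_measure" "(b - a) / (2 * pi) \<le> measure circle_measure I"
    by (auto elim: circle_arcE)
  have "0 < (b - a) / (2 * pi)" using I(1) by simp
  then have pos: "0 < measure circle_measure I" using I(3) by linarith
  have "(\<integral>\<^sup>+\<zeta>\<in>I. indicator S \<zeta> \<partial>circle_measure) = emeasure circle_measure (S \<inter> I)"
    using assms I(2) by (simp flip: indicator_inter_arith)
  then show "(\<integral>\<^sup>+\<zeta>\<in>I. indicator S \<zeta> \<partial>circle_measure) / emeasure circle_measure I =
      ennreal (measure circle_measure (S \<inter> I) / measure circle_measure I)"
    using pos by (simp add: circle.emeasure_eq_measure divide_ennreal)
qed

lemma cis_inj_window:
  assumes "cis x = cis y" "a \<le> x" "x < a + 2 * pi" "a \<le> y" "y < a + 2 * pi"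
  shows "x = y"
proof -
  have "- pi < (x - y) / 2" using assms(2-5) by argo
  moreover have "(x - y) / 2 < pi" using assms(2-5) by argo
  moreover have "2 * \<bar>sin ((x - y) / 2)\<bar> = 0"
    by (simp only: assms(1) diff_self norm_zero flip: cmod_cis_diff)
  then have "sin ((x - y) / 2) = 0" by linarith
  ultimately have "(x - y) / 2 = 0"
    by (rule sin_eq_0_pi)
  then show ?thesis by simp
qed

lemma circle_arc_closed:
  assumes "0 < l" "l \<le> 2 * pi"
  shows "circle_arc (cis ` {a..a + l})"
  unfolding circle_arc_def
proof (intro exI conjI)
  show "a < a + l" "a + l \<le> a + 2 * pi" using assms by auto
  show "cis ` {a<..<a + l} \<subseteq> cis ` {a..a + l}"
    by (intro image_mono) auto
qed (rule order_refl)

text \<open>The strict bound \<open>l < 2 * pi\<close> keeps the right endpoint inside the half-open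
  window on which \<open>cis\<close> is injective.\<close>

lemma measure_circle_arc_le:
  assumes "0 < l" "l < 2 * pi"
  shows "measure circle_measure (cis ` {a..a + l}) \<le> l / (2 * pi)"
proof (rule measure_circle_measure_le)
  show "cis ` {a..a + l} \<in> sets circle_measure"
    by (rule circle_arc_measurable[OF circle_arc_closed]) (use assms in auto)
  show "0 \<le> l" using assms by simp
  show "x \<in> {a..a + l}" if x: "a \<le> x" "x < a + 2 * pi" "cis x \<in> cis ` {a..a + l}" for x
  proof -
    from x(3) obtain y where y: "cis x = cis y" "a \<le> y" "y \<le> a + l" by auto
    have "x = y"
      using x(1,2) y assms(2) by (intro cis_inj_window[of x y a]) linarith+
    then show ?thesis using y(2,3) by simp
  qed
qed

text \<open>A slightly longer arc loses little of the average, so a strict lower bound survives. The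
  gain is that \<open>\<zeta>\<close>, possibly an endpoint of \<open>I\<close>, becomes interior to
  \<open>J\<close>; this is what makes the maximal function lower semicontinuous.\<close>

lemma circle_arc_enlarge:
  assumes S: "S \<in> sets circle_measure" and I: "circle_arc I" "\<zeta> \<in> I"
    and q: "0 \<le> q" "q < measure circle_measure (S \<inter> I) / measure circle_measure I"
  obtains J \<delta> where "circle_arc J" "\<delta> > 0"
    "\<And>\<xi>. \<xi> \<in> unit_circle \<Longrightarrow> dist \<xi> \<zeta> < \<delta> \<Longrightarrow> \<xi> \<in> J"
    "q < measure circle_measure (S \<inter> J) / measure circle_measure J"
proof -
  obtain a b where ab: "a < b" "b \<le> a + 2 * pi" "I \<subseteq> cis ` {a..b}" "I \<in> sets circle_measure"
    "(b - a) / (2 * pi) \<le> measure circle_measure I"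
    by (rule circle_arcE[OF I(1)])
  \<comment> \<open>The normalized length of the parameter interval. Only
    \<open>l \<le> measure circle_measure I\<close> is known, which is enough to conclude
    \<open>q * l < v\<close>.\<close>
  define l where "l = (b - a) / (2 * pi)"
  define v where "v = measure circle_measure (S \<inter> I)"
  have l: "0 < l" "l \<le> 1" "l \<le> measure circle_measure I" "b = a + 2 * pi * l"
    using ab by (auto simp: l_def)
  have M: "0 < measure circle_measure I" using l(1,3) by linarith
  have "q * measure circle_measure I < v"
    using q(2) M unfolding v_def by (subst (asm) pos_less_divide_eq)
  moreover have "q * l \<le> q * measure circle_measure I"
    using l(3) q(1) by (rule mult_left_mono)
  ultimately have v: "q * l < v" by linarith
  have mono: "v \<le> measure circle_measure (S \<inter> J)" if "I \<subseteq> J" "J \<in> sets circle_measure" for J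
    unfolding v_def using that S by (intro circle.finite_measure_mono) auto
  show ?thesis
  proof (cases "l = 1")
    \<comment> \<open>There is no room to enlarge; \<open>I\<close> may be the circle without a
      point, and the full circle serves as \<open>J\<close>.\<close>
    case True
    have circle: "unit_circle = cis ` {0..0 + 2 * pi}"
    proof (intro subset_antisym subsetI)
      fix \<xi> assume "\<xi> \<in> unit_circle"
      then obtain x where "\<xi> = cis x" "0 \<le> x" "x < 0 + 2 * pi" by (rule unit_circle_cis_near)
      then show "\<xi> \<in> cis ` {0..0 + 2 * pi}" by auto
    qed auto
    have arc: "circle_arc unit_circle"
      unfolding circle by (rule circle_arc_closed) auto
    moreover have "measure circle_measure unit_circle = 1"
      using circle.prob_space by simp
    moreover have "v \<le> measure circle_measure (S \<inter> unit_circle)"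
      using ab(4) by (intro mono circle_arc_measurable[OF arc]) (auto simp: sets_circle_measure)
    ultimately show ?thesis
      using v True by (intro that[of unit_circle 1]) auto
  next
    case False
    \<comment> \<open>The first bound leaves \<open>q * (l + \<eta>) < v\<close>; the second keeps
      \<open>l + \<eta>\<close> below 1, so the arc lengthened by \<open>pi * \<eta>\<close> at each
      end still does not close up.\<close>
    define \<eta> where "\<eta> = min ((v - q * l) / (q + 1)) ((1 - l) / 2)"
    have \<eta>: "0 < \<eta>" "2 * \<eta> \<le> 1 - l" "\<eta> * (q + 1) \<le> v - q * l"
    proof -
      show "0 < \<eta>" using False l v q by (auto simp: \<eta>_def)
      have "\<eta> \<le> (1 - l) / 2" unfolding \<eta>_def by (rule min.cobounded2)
      then show "2 * \<eta> \<le> 1 - l" by (simp add: field_simps)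
      have "\<eta> \<le> (v - q * l) / (q + 1)" unfolding \<eta>_def by (rule min.cobounded1)
      then show "\<eta> * (q + 1) \<le> v - q * l"
        using q(1) by (simp add: pos_le_divide_eq)
    qed
    define J where "J = cis ` {(a - pi * \<eta>)..(a - pi * \<eta>) + 2 * pi * (l + \<eta>)}"
    have "l + \<eta> < 1" using \<eta> l False by linarith
    then have len: "0 < 2 * pi * (l + \<eta>)" "2 * pi * (l + \<eta>) < 2 * pi"
      using \<eta> l(1) by (simp_all add: add_pos_pos)
    have J: "circle_arc J" "measure circle_measure J \<le> l + \<eta>"
      unfolding J_def using circle_arc_closed[OF len(1)] measure_circle_arc_le[OF len] len by auto
    then have "J \<in> sets circle_measure" by (simp add: circle_arc_measurable)
    moreover have IJ: "I \<subseteq> J"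
    proof -
      have "0 < pi * \<eta>" using \<eta> by simp
      then have "{a..b} \<subseteq> {(a - pi * \<eta>)..(a - pi * \<eta>) + 2 * pi * (l + \<eta>)}"
        by (auto simp: l(4) distrib_left)
      then show ?thesis using ab(3) unfolding J_def by blast
    qed
    ultimately have "v \<le> measure circle_measure (S \<inter> J)" "measure circle_measure I \<le> measure circle_measure J"
      by (auto intro: mono circle.finite_measure_mono)
    moreover have "q * measure circle_measure J < v"
      using mult_left_mono[OF J(2) q(1)] \<eta> by (simp add: algebra_simps)
    ultimately have "q < measure circle_measure (S \<inter> J) / measure circle_measure J"
      using l(1,3) by (subst pos_less_divide_eq) auto
    \<comment> \<open>Chords are at least half the arcs, so the radius
      \<open>pi * \<eta> / 2\<close> keeps arguments within the margin
      \<open>pi * \<eta>\<close>.\<close>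
    moreover have "\<xi> \<in> J" if \<xi>: "\<xi> \<in> unit_circle" "dist \<xi> \<zeta> < pi * \<eta> / 2" for \<xi>
    proof -
      obtain x where x: "\<zeta> = cis x" "a \<le> x" "x \<le> b" using I(2) ab(3) by auto
      obtain y where y: "\<xi> = cis y" "x - pi \<le> y" "y < x - pi + 2 * pi"
        using \<xi>(1) by (rule unit_circle_cis_near)
      have "\<bar>y - x\<bar> / 2 \<le> dist \<xi> \<zeta>"
        unfolding dist_norm x(1) y(1) using y by (intro cmod_cis_diff_ge) auto
      also note \<xi>(2)
      finally have "\<bar>y - x\<bar> < pi * \<eta>" by simp
      then have "y \<in> {(a - pi * \<eta>)..(a - pi * \<eta>) + 2 * pi * (l + \<eta>)}"
        using x(2,3) unfolding l(4) by (simp add: algebra_simps abs_less_iff)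
      then show ?thesis using y by (auto simp: J_def)
    qed
    ultimately show ?thesis
      using J \<eta> by (intro that[of J "pi * \<eta> / 2"]) auto
  qed
qed

section \<open>Shadows and the maximal function of a function on the disc\<close>

lemma shadow_measurable: "shadow \<alpha> z \<in> sets circle_measure"
proof (cases "z \<in> unit_disc")
  case True
  then have "shadow \<alpha> z = unit_circle \<inter> cball z (\<alpha> * (1 - (cmod z)\<^sup>2))"
    by (auto simp: shadow_def stolz_angle_def dist_norm)
  then show ?thesis by (auto simp: sets_circle_measure unit_circle_def)
qed (auto simp: shadow_def stolz_angle_def sets_circle_measure)

lemma shadow_dist_le:
  assumes "\<alpha> \<ge> 0" "\<zeta> \<in> shadow \<alpha> z"
  shows "cmod (z - \<zeta>) \<le> 2 * \<alpha> * (1 - cmod z)"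
proof -
  have z: "cmod z < 1" and "cmod (z - \<zeta>) \<le> \<alpha> * (1 - (cmod z)\<^sup>2)"
    using assms by (auto simp: shadow_def stolz_angle_def unit_disc_def)
  note this(2)
  also have "1 - (cmod z)\<^sup>2 = (1 + cmod z) * (1 - cmod z)"
    by (simp add: power2_eq_square algebra_simps)
  also have "\<alpha> * \<dots> \<le> \<alpha> * (2 * (1 - cmod z))"
    using z assms(1) by (intro mult_left_mono mult_right_mono) auto
  finally show ?thesis by (simp add: mult_ac)
qed

text \<open>Two points of the shadow are joined through \<open>z\<close>, which bounds the diameter
  by \<open>4 * \<alpha> * (1 - cmod z)\<close>.\<close>

lemma measure_shadow_le:
  assumes "\<alpha> \<ge> 0" "z \<in> unit_disc"
  shows "measure circle_measure (shadow \<alpha> z) \<le> 8 * \<alpha> * (1 - cmod z)"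
proof -
  have "measure circle_measure (shadow \<alpha> z) \<le> 2 * (4 * \<alpha> * (1 - cmod z))"
  proof (rule measure_circle_diameter_le[OF shadow_measurable])
    fix \<zeta> \<xi> assume "\<zeta> \<in> shadow \<alpha> z" "\<xi> \<in> shadow \<alpha> z"
    then show "cmod (\<zeta> - \<xi>) \<le> 4 * \<alpha> * (1 - cmod z)"
      using shadow_dist_le[OF assms(1), of \<zeta> z] shadow_dist_le[OF assms(1), of \<xi> z]
        norm_triangle_sub[of "z - \<xi>" "z - \<zeta>"] norm_triangle_ineq4[of "z - \<xi>" "z - \<zeta>"] by simp
  qed (use assms in \<open>auto simp: unit_disc_def\<close>)
  then show ?thesis by simp
qed

text \<open>The scaled chord costs at most r(1 - r) and the radial gap 1 - r; they add up to exactly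
  1 - r^2. This is where \<alpha> \<ge> 1 enters.\<close>

lemma cis_in_shadow:
  assumes "\<alpha> \<ge> 1" "0 \<le> r" "r < 1" "\<bar>x - \<theta>\<bar> \<le> 1 - r"
  shows "cis x \<in> shadow \<alpha> (of_real r * cis \<theta>)"
proof -
  have "cmod (of_real r * cis \<theta> - cis x) \<le> cmod (of_real r * (cis \<theta> - cis x)) + cmod (of_real (1 - r) * cis x)"
    using norm_triangle_ineq4[of "of_real r * (cis \<theta> - cis x)" "of_real (1 - r) * cis x"]
    by (simp add: algebra_simps)
  also have "\<dots> \<le> r * (1 - r) + (1 - r)"
    using cmod_cis_diff_le[of \<theta> x] assms
    by (intro add_mono) (auto simp: norm_mult simp del: of_real_diff intro!: mult_left_mono)
  also have "\<dots> = 1 * (1 - r\<^sup>2)" by (simp add: power2_eq_square algebra_simps)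
  also have "\<dots> \<le> \<alpha> * (1 - r\<^sup>2)"
    using assms by (intro mult_right_mono) (auto simp: power_le_one)
  finally show ?thesis
    using assms by (simp add: shadow_def stolz_angle_def unit_disc_def norm_mult)
qed

text \<open>In this form a strict lower bound is witnessed by one point \<open>z\<close> and one arc
  \<open>I\<close>, with all arithmetic in the reals.\<close>

lemma hl_stolz_maximal_eq:
  assumes "\<And>z. z \<in> unit_disc \<Longrightarrow> 0 \<le> \<phi> z"
  shows "hl_stolz_maximal \<alpha> \<phi> \<zeta> = (SUP z \<in> unit_disc. SUP I \<in> {I. circle_arc I \<and> \<zeta> \<in> I}.
    ennreal (\<phi> z * (measure circle_measure (shadow \<alpha> z \<inter> I) / measure circle_measure I)))"
proof -
  have "ennreal (\<phi> z) * hl_maximal (indicator (shadow \<alpha> z)) \<zeta> = (SUP I \<in> {I. circle_arc I \<and> \<zeta> \<in> I}.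
    ennreal (\<phi> z * (measure circle_measure (shadow \<alpha> z \<inter> I) / measure circle_measure I)))"
    if "z \<in> unit_disc" for z
    using assms[OF that]
    by (simp add: hl_maximal_indicator[OF shadow_measurable] SUP_mult_left_ennreal flip: ennreal_mult)
  then show ?thesis
    unfolding hl_stolz_maximal_def by (rule SUP_cong[OF refl])
qed

text \<open>The supremum over \<open>z\<close> and over arcs is uncountable; measurability comes from lower
  semicontinuity, by enlarging the arcs slightly.\<close>

lemma hl_stolz_maximal_measurable:
  assumes nonneg: "\<And>z. z \<in> unit_disc \<Longrightarrow> 0 \<le> \<phi> z"
  shows "hl_stolz_maximal \<alpha> \<phi> \<in> borel_measurable circle_measure"
proof (rule borel_measurableI_greater)
  fix c :: ennreal
  let ?E = "{\<zeta> \<in> unit_circle. c < hl_stolz_maximal \<alpha> \<phi> \<zeta>}"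
  have "openin (top_of_set unit_circle) ?E"
    unfolding openin_euclidean_subtopology_iff
  proof (intro conjI ballI)
    fix \<zeta> assume "\<zeta> \<in> ?E"
    then obtain z I where z: "z \<in> unit_disc" and I: "circle_arc I" "\<zeta> \<in> I"
      and c: "c < ennreal (\<phi> z * (measure circle_measure (shadow \<alpha> z \<inter> I) / measure circle_measure I))"
      by (auto simp: hl_stolz_maximal_eq[OF nonneg] less_SUP_iff)
    obtain q where q: "c = ennreal q" "0 \<le> q"
      using c by (cases c) auto
    have less: "q < \<phi> z * (measure circle_measure (shadow \<alpha> z \<inter> I) / measure circle_measure I)"
      using c q by (simp add: ennreal_less_iff)
    then have pos: "0 < \<phi> z"
      using q(2) nonneg[OF z] by (cases "\<phi> z = 0") auto
    \<comment> \<open>Dividing by \<open>\<phi> z\<close> isolates the average over the arc. Keeping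
      \<open>z\<close> and enlarging the arc then serves all nearby points at once.\<close>
    then have "q / \<phi> z < measure circle_measure (shadow \<alpha> z \<inter> I) / measure circle_measure I"
      using less by (simp add: pos_divide_less_eq mult.commute)
    with q pos obtain J \<delta> where J: "circle_arc J" "\<delta> > 0"
      "\<And>\<xi>. \<xi> \<in> unit_circle \<Longrightarrow> dist \<xi> \<zeta> < \<delta> \<Longrightarrow> \<xi> \<in> J"
      "q / \<phi> z < measure circle_measure (shadow \<alpha> z \<inter> J) / measure circle_measure J"
      by (elim circle_arc_enlarge[OF shadow_measurable I, rotated]) auto
    have "c < ennreal (\<phi> z * (measure circle_measure (shadow \<alpha> z \<inter> J) / measure circle_measure J))"
      using J(4) q pos by (simp add: ennreal_less_iff pos_divide_less_eq mult.commute)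
    with J(1,3) z have "\<xi> \<in> ?E" if "\<xi> \<in> unit_circle" "dist \<xi> \<zeta> < \<delta>" for \<xi>
      using that by (auto simp: hl_stolz_maximal_eq[OF nonneg] less_SUP_iff)
    with J(2) show "\<exists>e>0. \<forall>\<xi>\<in>unit_circle. dist \<xi> \<zeta> < e \<longrightarrow> \<xi> \<in> ?E"
      by blast
  qed auto
  then obtain T where "open T" "?E = unit_circle \<inter> T" by (auto simp: openin_open)
  then show "{\<zeta> \<in> space circle_measure. c < hl_stolz_maximal \<alpha> \<phi> \<zeta>} \<in> sets circle_measure"
    by (auto simp: sets_circle_measure unit_circle_def)
qed

lemma weak_L1_I:
  assumes "f \<in> borel_measurable circle_measure"
    and bound: "\<And>t. t > 0 \<Longrightarrow> t * measure circle_measure {\<zeta> \<in> unit_circle. ennreal t < f \<zeta>} \<le> K"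
  shows "f \<in> weak_L1"
proof -
  have "(SUP t \<in> {0::real<..}. ennreal t * emeasure circle_measure {\<zeta> \<in> unit_circle. f \<zeta> > ennreal t}) \<le> ennreal K"
    using bound by (intro SUP_least) (auto simp: circle.emeasure_eq_measure ennreal_leI simp flip: ennreal_mult)
  then show ?thesis
    using assms(1) by (auto simp: weak_L1_def intro: le_less_trans)
qed

section \<open>The mean value property of harmonic functions\<close>

text \<open>With A(s) the integral of h over the circle of radius s, let B and C be its first two
  derivatives. The Laplace equation in polar form, integrated over the circle, gives B + sC = 0,
  that is (sB)' = 0. Hence B = 0 and A is constant.\<close>

lemma harmonic_circle_mean:
  assumes harm: "harmonic_fun_on h (ball 0 1)" and r: "0 < r" "r < 1"
  shows "integral {0..2 * pi} (\<lambda>t. h (of_real r * cis t)) = 2 * pi * h 0"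
proof -
  obtain h' h'' where
    h': "\<And>z. z \<in> ball 0 1 \<Longrightarrow> (h has_derivative blinfun_apply (h' z)) (at z)" and
    h'': "\<And>z. z \<in> ball 0 1 \<Longrightarrow> (h' has_derivative blinfun_apply (h'' z)) (at z)" and
    cont2: "continuous_on (ball 0 1) h''" and
    laplace: "\<And>z. z \<in> ball 0 1 \<Longrightarrow> h'' z 1 1 + h'' z \<i> \<i> = 0"
    using harm unfolding harmonic_fun_on_def by blast
  define p where "p s t = complex_of_real s * cis t" for s t
  \<comment> \<open>Signed radii make \<open>0\<close> an interior point.\<close>
  define U :: "real set" where "U = {-1<..<1}"
  have U: "open U" "convex U" by (simp_all add: U_def)
  have p: "p s t \<in> ball 0 1" if "s \<in> U" for s t
    using that by (auto simp: p_def U_def norm_mult)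
  have cont0: "continuous_on (ball 0 1) h" and cont1: "continuous_on (ball 0 1) h'"
    using h' h'' by (meson continuous_at_imp_continuous_on has_derivative_continuous)+
  have cont: "continuous_on (U \<times> V) (\<lambda>x. g (p (fst x) (snd x)))"
    if "continuous_on (ball 0 1) g" for g :: "complex \<Rightarrow> 'x::topological_space" and V
  proof (rule continuous_on_compose2[OF that])
    show "continuous_on (U \<times> V) (\<lambda>x. p (fst x) (snd x))"
      unfolding p_def by (intro continuous_intros)
  qed (use p in auto)
  have cont_t: "continuous_on V (\<lambda>t. g (p s t))"
    if "continuous_on (ball 0 1) g" "s \<in> U" for g :: "complex \<Rightarrow> 'x::topological_space" and V s
  proof (rule continuous_on_compose2[OF that(1)])
    show "continuous_on V (p s)"
      unfolding p_def by (intro continuous_intros)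
  qed (use p that in auto)
  have p_deriv: "((\<lambda>s. p s t) has_derivative (\<lambda>u. u *\<^sub>R cis t)) (at s)" for s t
    unfolding p_def by (auto intro!: derivative_eq_intros simp: scaleR_conv_of_real)
  have D1: "((\<lambda>s. h (p s t)) has_field_derivative h' (p s t) (cis t)) (at s)" if "s \<in> U" for s t
    using has_derivative_compose[OF p_deriv h'[OF p[OF that]], of t]
    by (simp add: has_field_derivative_def blinfun.scaleR_right mult_commute_abs)
  have D2: "((\<lambda>s. h' (p s t) (cis t)) has_field_derivative h'' (p s t) (cis t) (cis t)) (at s)"
    if "s \<in> U" for s t
    using bounded_linear.has_derivative[OF blinfun.bounded_linear_left
        has_derivative_compose[OF p_deriv h''[OF p[OF that]], of t], of "cis t"]
    by (simp add: has_field_derivative_def blinfun.scaleR_right blinfun.scaleR_left mult_commute_abs)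
  \<comment> \<open>Moving along the circle also turns the tangent \<open>\<i> * cis t\<close>,
    whose derivative \<open>- cis t\<close> produces the first-order term.\<close>
  have D3: "((\<lambda>t. h' (p s t) (\<i> * cis t)) has_vector_derivative
      s * h'' (p s t) (\<i> * cis t) (\<i> * cis t) - h' (p s t) (cis t)) (at t)" if "s \<in> U" for s t
  proof -
    have "((\<lambda>t. p s t) has_derivative (\<lambda>u. u *\<^sub>R (of_real s * (\<i> * cis t)))) (at t)"
      unfolding p_def by (auto intro!: derivative_eq_intros simp: scaleR_conv_of_real algebra_simps)
    from has_derivative_compose[OF this h''[OF p[OF that]]]
    have "((\<lambda>t. h' (p s t)) has_derivative (\<lambda>u. u *\<^sub>R (s *\<^sub>R h'' (p s t) (\<i> * cis t)))) (at t)"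
      by (simp add: blinfun.scaleR_right flip: scaleR_conv_of_real)
    moreover have "((\<lambda>t. \<i> * cis t) has_derivative (\<lambda>u. u *\<^sub>R (- cis t))) (at t)"
      by (auto intro!: derivative_eq_intros simp: fun_eq_iff complex_eq_iff)
    ultimately have "((\<lambda>t. h' (p s t) (\<i> * cis t)) has_derivative
       (\<lambda>u. h' (p s t) (u *\<^sub>R (- cis t)) + (u *\<^sub>R (s *\<^sub>R h'' (p s t) (\<i> * cis t))) (\<i> * cis t))) (at t)"
      by (rule blinfun.FDERIV)
    then show ?thesis
      by (simp add: has_vector_derivative_def blinfun.scaleR_right blinfun.scaleR_left blinfun.minus_right
          algebra_simps)
  qed
  \<comment> \<open>The mixed derivatives cancel, so no symmetry of \<open>h''\<close> is needed.\<close>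
  have polar: "h'' z (\<i> * cis t) (\<i> * cis t) = - h'' z (cis t) (cis t)" if "z \<in> ball 0 1" for z t
  proof -
    have e: "cis t = cos t *\<^sub>R 1 + sin t *\<^sub>R \<i>" "\<i> * cis t = (- sin t) *\<^sub>R 1 + cos t *\<^sub>R \<i>"
      by (auto simp: complex_eq_iff)
    have expand: "h'' z (a *\<^sub>R 1 + b *\<^sub>R \<i>) (a *\<^sub>R 1 + b *\<^sub>R \<i>)
        = a\<^sup>2 * h'' z 1 1 + a * b * (h'' z 1 \<i> + h'' z \<i> 1) + b\<^sup>2 * h'' z \<i> \<i>" for a b
      by (simp add: blinfun.add_left blinfun.add_right blinfun.scaleR_left blinfun.scaleR_right
          algebra_simps power2_eq_square)
    have "h'' z (\<i> * cis t) (\<i> * cis t)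
        = (- sin t)\<^sup>2 * h'' z 1 1 + - sin t * cos t * (h'' z 1 \<i> + h'' z \<i> 1) + (cos t)\<^sup>2 * h'' z \<i> \<i>"
      unfolding e(2) by (rule expand)
    moreover have "h'' z (cis t) (cis t)
        = (cos t)\<^sup>2 * h'' z 1 1 + cos t * sin t * (h'' z 1 \<i> + h'' z \<i> 1) + (sin t)\<^sup>2 * h'' z \<i> \<i>"
      unfolding e(1) by (rule expand)
    ultimately have "h'' z (\<i> * cis t) (\<i> * cis t) + h'' z (cis t) (cis t)
        = ((sin t)\<^sup>2 + (cos t)\<^sup>2) * (h'' z 1 1 + h'' z \<i> \<i>)"
      by (simp add: algebra_simps del: sin_cos_squared_add sin_cos_squared_add2)
    then show ?thesis using laplace[OF that] by simp
  qed
  define A where "A s = integral {0..2 * pi} (\<lambda>t. h (p s t))" for s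
  define B where "B s = integral {0..2 * pi} (\<lambda>t. h' (p s t) (cis t))" for s
  define C where "C s = integral {0..2 * pi} (\<lambda>t. h'' (p s t) (cis t) (cis t))" for s
  have cis_snd: "continuous_on V (\<lambda>x :: real \<times> real. cis (snd x))" for V
    by (intro continuous_intros)
  have int0: "(\<lambda>t. h (p s t)) integrable_on {0..2 * pi}"
    and int1: "(\<lambda>t. h' (p s t) (cis t)) integrable_on {0..2 * pi}"
    and int2: "(\<lambda>t. h'' (p s t) (cis t) (cis t)) integrable_on {0..2 * pi}" if "s \<in> U" for s
    by (intro integrable_continuous_interval blinfun.continuous_on cont_t[OF cont0 that]
        cont_t[OF cont1 that] cont_t[OF cont2 that] continuous_intros)+
  have A: "(A has_field_derivative B s) (at s)" if "s \<in> U" for s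
  proof -
    have "(A has_field_derivative B s) (at s within U)"
      unfolding A_def[abs_def] B_def box_real(2)[symmetric]
    proof (rule leibniz_rule_field_derivative[where fx = "\<lambda>s t. h' (p s t) (cis t)"])
      show "continuous_on (U \<times> cbox 0 (2 * pi)) (\<lambda>(s, t). h' (p s t) (cis t))"
        unfolding case_prod_unfold by (intro blinfun.continuous_on cont[OF cont1] cis_snd)
    qed (use that U in \<open>simp_all add: has_field_derivative_at_within D1 int0\<close>)
    then show ?thesis by (simp only: at_within_open[OF that U(1)])
  qed
  have B: "(B has_field_derivative C s) (at s)" if "s \<in> U" for s
  proof -
    have "(B has_field_derivative C s) (at s within U)"
      unfolding B_def[abs_def] C_def box_real(2)[symmetric]
    proof (rule leibniz_rule_field_derivative[where fx = "\<lambda>s t. h'' (p s t) (cis t) (cis t)"])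
      show "continuous_on (U \<times> cbox 0 (2 * pi)) (\<lambda>(s, t). h'' (p s t) (cis t) (cis t))"
        unfolding case_prod_unfold by (intro blinfun.continuous_on cont[OF cont2] cis_snd)
    qed (use that U in \<open>simp_all add: has_field_derivative_at_within D2 int1\<close>)
    then show ?thesis by (simp only: at_within_open[OF that U(1)])
  qed
  \<comment> \<open>The tangential derivative takes the same value at both ends of the period, so
    the integral of its derivative is 0; \<open>polar\<close> then trades tangential for radial
    second derivatives.\<close>
  have BC: "B s + s * C s = 0" if "s \<in> U" for s
  proof -
    let ?F = "\<lambda>t. s * h'' (p s t) (\<i> * cis t) (\<i> * cis t) - h' (p s t) (cis t)"
    have "(?F has_integral h' (p s (2 * pi)) (\<i> * cis (2 * pi)) - h' (p s 0) (\<i> * cis 0)) {0..2 * pi}"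
      by (rule fundamental_theorem_of_calculus) (auto intro: has_vector_derivative_at_within D3 that)
    moreover have "(?F has_integral s * (- C s) - B s) {0..2 * pi}"
      unfolding B_def C_def polar[OF p[OF that]]
      by (intro has_integral_diff has_integral_mult_right has_integral_neg integrable_integral int1 int2 that)
    ultimately have "s * (- C s) - B s = 0"
      by (auto dest: has_integral_unique simp: p_def)
    then show ?thesis by simp
  qed
  have sub: "s \<in> U" if "0 \<le> s" "s \<le> r" for s using that r by (auto simp: U_def)
  \<comment> \<open>\<open>s * B s\<close> is constant and vanishes at 0, where the factor
    \<open>s\<close> does; division is possible for positive \<open>s\<close>.\<close>
  have B0: "B s = 0" if "0 < s" "s < r" for s
  proof -
    have deriv: "((\<lambda>s. s * B s) has_field_derivative 0) (at u)" if "u \<in> U" for u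
      using BC[OF that] by (auto intro!: derivative_eq_intros B that simp: algebra_simps)
    have "s * B s = 0 * B 0"
    proof (rule DERIV_isconst_end[where f = "\<lambda>s. s * B s"])
      show "continuous_on {0..s} (\<lambda>s. s * B s)"
      proof (intro continuous_at_imp_continuous_on ballI)
        fix u assume "u \<in> {0..s}"
        then show "isCont (\<lambda>s. s * B s) u"
          using that by (intro DERIV_isCont[OF deriv[OF sub]]) auto
      qed
      show "((\<lambda>s. s * B s) has_field_derivative 0) (at u)" if "0 < u" "u < s" for u
        using that \<open>s < r\<close> by (intro deriv sub) auto
    qed fact
    then show ?thesis using that by simp
  qed
  have "A r = A 0"
  proof (rule DERIV_isconst_end[where f = A])
    show "continuous_on {0..r} A"
    proof (intro continuous_at_imp_continuous_on ballI)
      fix s assume "s \<in> {0..r}"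
      then show "isCont A s"
        by (intro DERIV_isCont[OF A[OF sub]]) auto
    qed
    show "(A has_field_derivative 0) (at s)" if "0 < s" "s < r" for s
      using A[of s] B0[OF that] sub that by simp
  qed (rule r(1))
  then show ?thesis by (simp add: A_def p_def)
qed

section \<open>The function $1 / |z - 1|$\<close>

text \<open>An arc through \<open>\<zeta>\<close> that meets the shadow of \<open>z\<close> must be
  long unless \<open>z\<close> is itself far from 1: going from \<open>\<zeta>\<close> to 1 through
  a common point and \<open>z\<close> bounds the distance by \<open>2 * pi\<close> times the measure
  of the arc plus a multiple of \<open>cmod (z - 1)\<close>.\<close>

lemma hl_stolz_maximal_inverse_dist_le:
  assumes "\<alpha> \<ge> 0" "\<zeta> \<in> unit_circle" "\<zeta> \<noteq> 1"
  shows "hl_stolz_maximal \<alpha> (\<lambda>z. 1 / cmod (z - 1)) \<zeta>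
    \<le> ennreal ((16 * pi * \<alpha> + 2 * \<alpha> + 1) / cmod (\<zeta> - 1))"
proof (subst hl_stolz_maximal_eq, simp, intro SUP_least ennreal_leI)
  fix z I assume z: "z \<in> unit_disc" and "I \<in> {I. circle_arc I \<and> \<zeta> \<in> I}"
  then have I: "circle_arc I" "\<zeta> \<in> I" by auto
  obtain a b where ab: "a < b" "b \<le> a + 2 * pi" "cis ` {a<..<b} \<subseteq> I" "I \<subseteq> cis ` {a..b}"
    "I \<in> sets circle_measure" "(b - a) / (2 * pi) \<le> measure circle_measure I"
    by (rule circle_arcE[OF I(1)])
  let ?S = "shadow \<alpha> z" and ?m = "measure circle_measure"
  have "0 < (b - a) / (2 * pi)" using ab(1) by simp
  then have I_pos: "0 < ?m I" using ab(6) by linarith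
  have z1: "cmod z < 1" using z by (simp add: unit_disc_def)
  have gap: "1 - cmod z \<le> cmod (z - 1)"
    using norm_triangle_ineq2[of 1 z] by (simp add: norm_minus_commute)
  have z_pos: "0 < cmod (z - 1)" using gap z1 by linarith
  have \<zeta>_pos: "0 < cmod (\<zeta> - 1)" using assms(3) by simp
  \<comment> \<open>Clears all denominators, reducing the claim to one product inequality.\<close>
  have quotient_le: "1 / c * (m / M) \<le> k / w"
    if "m * w \<le> k * c * M" "0 < c" "0 < M" "0 < w" for c m M k w :: real
    using that by (simp add: field_simps)
  have "?m (?S \<inter> I) * cmod (\<zeta> - 1) \<le> (16 * pi * \<alpha> + 2 * \<alpha> + 1) * cmod (z - 1) * ?m I"
  proof (cases "?S \<inter> I = {}")
    case True
    then show ?thesis using assms(1) by simp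
  next
    case False
    then obtain \<xi> where \<xi>: "\<xi> \<in> ?S" "\<xi> \<in> I" by auto
    obtain x y where xy: "\<zeta> = cis x" "\<xi> = cis y" "x \<in> {a..b}" "y \<in> {a..b}"
      using \<xi>(2) I(2) ab(4) by blast
    have "cmod (\<zeta> - \<xi>) \<le> \<bar>x - y\<bar>" unfolding xy by (rule cmod_cis_diff_le)
    also have "\<dots> \<le> b - a" using xy by auto
    also have "\<dots> \<le> 2 * pi * ?m I" using ab(6) by (simp add: field_simps)
    finally have 1: "cmod (\<zeta> - \<xi>) \<le> 2 * pi * ?m I" .
    have 2: "cmod (z - \<xi>) \<le> 2 * \<alpha> * cmod (z - 1)"
      using shadow_dist_le[OF assms(1) \<xi>(1)] mult_left_mono[OF gap, of "2 * \<alpha>"] assms(1) by linarith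
    have "cmod (\<zeta> - 1) \<le> cmod (\<zeta> - \<xi>) + (cmod (z - \<xi>) + cmod (z - 1))"
      using norm_triangle_ineq[of "\<zeta> - \<xi>" "\<xi> - 1"] norm_triangle_ineq[of "\<xi> - z" "z - 1"]
      by (simp add: norm_minus_commute)
    with 1 2 have 3: "cmod (\<zeta> - 1) \<le> 2 * pi * ?m I + (2 * \<alpha> + 1) * cmod (z - 1)"
      by (simp add: algebra_simps)
    have SI: "?m (?S \<inter> I) \<le> ?m I" "?m (?S \<inter> I) \<le> ?m ?S"
      using ab(5) shadow_measurable by (auto intro!: circle.finite_measure_mono)
    have S: "?m ?S \<le> 8 * \<alpha> * cmod (z - 1)"
      using measure_shadow_le[OF assms(1) z] mult_left_mono[OF gap, of "8 * \<alpha>"] assms(1) by linarith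
    have "?m (?S \<inter> I) * cmod (\<zeta> - 1)
        \<le> ?m (?S \<inter> I) * (2 * pi * ?m I) + ?m (?S \<inter> I) * ((2 * \<alpha> + 1) * cmod (z - 1))"
      using mult_left_mono[OF 3, of "?m (?S \<inter> I)"] by (simp add: distrib_left)
    \<comment> \<open>The intersection is bounded by the shadow in the first summand and by the arc
      in the second, so both acquire the factor \<open>cmod (z - 1)\<close> times the measure of the
      arc.\<close>
    also have "\<dots> \<le> (8 * \<alpha> * cmod (z - 1)) * (2 * pi * ?m I) + ?m I * ((2 * \<alpha> + 1) * cmod (z - 1))"
      using SI S assms(1) by (intro add_mono mult_right_mono) auto
    finally show ?thesis by (simp add: algebra_simps)
  qed
  then show "1 / cmod (z - 1) * (?m (?S \<inter> I) / ?m I) \<le> (16 * pi * \<alpha> + 2 * \<alpha> + 1) / cmod (\<zeta> - 1)"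
    by (rule quotient_le) fact+
qed

text \<open>The level set at height \<open>t\<close> lies within distance \<open>K / t\<close> of 1,
  so its diameter is at most \<open>2 * K / t\<close>.\<close>

lemma hl_stolz_maximal_inverse_dist_weak_L1:
  assumes "\<alpha> \<ge> 0"
  shows "hl_stolz_maximal \<alpha> (\<lambda>z. 1 / cmod (z - 1)) \<in> weak_L1"
proof (rule weak_L1_I)
  let ?H = "hl_stolz_maximal \<alpha> (\<lambda>z. 1 / cmod (z - 1))"
  define K where "K = 16 * pi * \<alpha> + 2 * \<alpha> + 1"
  have K: "0 < K" using assms by (simp add: K_def add_nonneg_pos)
  show H: "?H \<in> borel_measurable circle_measure"
    by (rule hl_stolz_maximal_measurable) simp
  fix t :: real assume t: "0 < t"
  let ?E = "{\<zeta> \<in> unit_circle. ennreal t < ?H \<zeta>}"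
  have near: "cmod (\<zeta> - 1) \<le> K / t" if "\<zeta> \<in> ?E" for \<zeta>
  \<comment> \<open>The pointwise estimate excludes the point 1, but there the distance is
    0.\<close>
  proof (cases "\<zeta> = 1")
    case False
    have "ennreal t < ennreal (K / cmod (\<zeta> - 1))"
      using that hl_stolz_maximal_inverse_dist_le[OF assms _ False] by (auto simp: K_def intro: less_le_trans)
    then have "t < K / cmod (\<zeta> - 1)" using t by (simp add: ennreal_less_iff)
    then show ?thesis using False t by (simp add: field_simps)
  qed (use K t in simp)
  have E: "?E \<in> sets circle_measure"
  proof -
    have "?E = ?H -` {ennreal t<..} \<inter> space circle_measure" by auto
    then show ?thesis using measurable_sets[OF H] by simp
  qed
  have "measure circle_measure ?E \<le> 2 * (2 * K / t)"
  proof (rule measure_circle_diameter_le[OF E])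
    fix \<zeta> \<xi> assume "\<zeta> \<in> ?E" "\<xi> \<in> ?E"
    then show "cmod (\<zeta> - \<xi>) \<le> 2 * K / t"
      using near[of \<zeta>] near[of \<xi>] norm_triangle_ineq4[of "\<zeta> - 1" "\<xi> - 1"] by simp
  qed (use K t in simp)
  then have "t * measure circle_measure ?E \<le> t * (2 * (2 * K / t))"
    using t by (intro mult_left_mono) auto
  also have "\<dots> = 4 * K" using t by simp
  finally show "t * measure circle_measure ?E \<le> 4 * K" .
qed

lemma no_harmonic_majorant_inverse_dist:
  "\<not> positive_harmonic_majorant h (\<lambda>z. 1 / cmod (z - 1))"
proof
  assume maj: "positive_harmonic_majorant h (\<lambda>z. 1 / cmod (z - 1))"
  then have h: "0 \<le> h z" "1 / cmod (z - 1) \<le> h z" if "cmod z < 1" for z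
    using that by (auto simp: positive_harmonic_majorant_def unit_disc_def)
  have harm: "harmonic_fun_on h (ball 0 1)"
    using maj by (simp add: positive_harmonic_majorant_def unit_disc_def)
  \<comment> \<open>Chosen so that \<open>- ln d\<close> exceeds the circle integral
    \<open>2 * pi * h 0\<close> by 1; \<open>h 0 \<ge> 0\<close> makes \<open>d < 1\<close>, so the
    radius \<open>r = 1 - d\<close> is positive.\<close>
  define d where "d = exp (- (2 * pi * h 0 + 1))"
  define r where "r = 1 - d"
  have "0 \<le> 2 * pi * h 0" using h(1)[of 0] by simp
  then have "- (2 * pi * h 0 + 1) < 0" by linarith
  then have d: "0 < d" "d < 1"
    by (simp_all only: d_def exp_gt_zero exp_less_one_iff)
  have r: "0 < r" "r < 1" using d by (simp_all add: r_def)
  let ?f = "\<lambda>t. h (of_real r * cis t)"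
  have disc: "cmod (of_real r * cis t) < 1" for t using r by (simp add: norm_mult)
  have cont: "continuous_on UNIV ?f"
  proof (rule continuous_on_compose2[of "ball 0 1" h])
    show "continuous_on (ball 0 1) h"
      using harm unfolding harmonic_fun_on_def
      by (metis continuous_at_imp_continuous_on has_derivative_continuous)
  qed (use disc in \<open>auto intro!: continuous_intros\<close>)
  have int: "?f integrable_on {u..v}" for u v
    using cont by (intro integrable_continuous_interval) (rule continuous_on_subset, auto)
  have ln_int: "((\<lambda>t. 1 / (t + d)) has_integral ln (1 + d) - ln (0 + d)) {0..1}"
    using d by (intro fundamental_theorem_of_calculus)
      (auto intro!: derivative_eq_intros simp flip: has_real_derivative_iff_has_vector_derivative)
  have "2 * pi * h 0 + 1 = - ln d" by (simp add: d_def)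
  also have "\<dots> \<le> ln (1 + d) - ln (0 + d)" using d by simp
  also have "\<dots> \<le> integral {0..1} ?f"
  proof (rule has_integral_le[OF ln_int integrable_integral[OF int]])
    \<comment> \<open>The distance to 1 is at most \<open>t\<close> along the circle plus
      \<open>d\<close> radially.\<close>
    fix t :: real assume t: "t \<in> {0..1}"
    have "cmod (of_real r * cis t - 1) \<le> cmod (of_real r * (cis t - cis 0)) + cmod (of_real r - 1)"
      using norm_triangle_ineq[of "of_real r * (cis t - cis 0)" "of_real r - 1"]
      by (simp add: algebra_simps)
    also have "cmod (of_real r - 1) = d"
      using d norm_of_real[of "r - 1"] by (simp add: r_def)
    also have "cmod (of_real r * (cis t - cis 0)) \<le> 1 * t"
      using cmod_cis_diff_le[of t 0] r t unfolding norm_mult by (intro mult_mono) auto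
    finally have "cmod (of_real r * cis t - 1) \<le> t + d" by simp
    moreover have "of_real r * cis t \<noteq> 1" using disc[of t] by auto
    ultimately have "1 / (t + d) \<le> 1 / cmod (of_real r * cis t - 1)"
      using t d by (intro divide_left_mono) (auto intro!: mult_pos_pos add_nonneg_pos)
    also have "\<dots> \<le> ?f t" by (rule h(2)[OF disc])
    finally show "1 / (t + d) \<le> ?f t" .
  qed
  \<comment> \<open>Positivity of the majorant allows the passage from a piece of the circle to all
    of it.\<close>
  also have "\<dots> \<le> integral {0..2 * pi} ?f"
    using pi_gt3 h(1)[OF disc] by (intro integral_subset_le int) auto
  also have "\<dots> = 2 * pi * h 0"
    by (rule harmonic_circle_mean[OF harm r])
  finally show False by simp
qed

section \<open>Point masses along a spiral\<close>

text \<open>The angles \<open>sqrt j\<close> are unbounded while their consecutive gaps tend to 0,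
  so every tail comes arbitrarily close to each direction.\<close>

definition spiral :: "nat \<Rightarrow> complex" where
  "spiral j = of_real (1 - (1/2) ^ j) * cis (sqrt (real j))"

text \<open>Reading the weight \<open>2 ^ j\<close> off the modulus defines it without inverting
  \<open>spiral\<close>.\<close>

definition spiral_weight :: "complex \<Rightarrow> real" where
  "spiral_weight z = indicator (range spiral) z / (1 - cmod z)"

lemma cmod_spiral: "cmod (spiral j) = 1 - (1/2) ^ j"
  by (simp add: spiral_def norm_mult power_le_one del: of_real_diff)

lemma spiral_in_disc: "spiral j \<in> unit_disc"
  by (simp add: unit_disc_def cmod_spiral)

lemma spiral_weight_spiral: "spiral_weight (spiral j) = 2 ^ j"
  by (simp add: spiral_weight_def cmod_spiral power_divide)

lemma spiral_weight_nonneg: "z \<in> unit_disc \<Longrightarrow> 0 \<le> spiral_weight z"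
  by (simp add: spiral_weight_def unit_disc_def)

lemma spiral_weight_borel: "spiral_weight \<in> borel_measurable borel"
proof -
  have "range spiral \<in> sets borel"
    by (rule sets.countable) auto
  then show ?thesis
    unfolding spiral_weight_def[abs_def] by (intro borel_measurable_divide borel_measurable_indicator) auto
qed

text \<open>The shadows have measure at most \<open>8 * \<alpha> / 2 ^ j\<close>, so the sum over
  all \<open>j \<ge> k\<close> is geometric and comparable to its first term.\<close>

lemma stolz_maximal_spiral_weight:
  assumes "\<alpha> \<ge> 0"
  shows "stolz_maximal \<alpha> spiral_weight \<in> weak_L1"
proof (rule weak_L1_I)
  let ?M = "stolz_maximal \<alpha> spiral_weight"
  \<comment> \<open>Off the spiral the weight is 0 and cannot exceed \<open>c\<close>. The level set
    is thus a countable union of shadows, which also yields measurability.\<close>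
  have level: "{\<zeta> \<in> unit_circle. c < ?M \<zeta>} = (\<Union>j\<in>{j. c < ennreal (2 ^ j)}. shadow \<alpha> (spiral j))" for c
  proof (intro subset_antisym subsetI)
    fix \<zeta> assume "\<zeta> \<in> {\<zeta> \<in> unit_circle. c < ?M \<zeta>}"
    then obtain z where z: "\<zeta> \<in> unit_circle" "z \<in> stolz_angle \<alpha> \<zeta>" "c < ennreal (spiral_weight z)"
      by (auto simp: stolz_maximal_def less_SUP_iff)
    then have "spiral_weight z \<noteq> 0" by auto
    then obtain j where "z = spiral j" by (auto simp: spiral_weight_def split: split_indicator_asm)
    with z show "\<zeta> \<in> (\<Union>j\<in>{j. c < ennreal (2 ^ j)}. shadow \<alpha> (spiral j))"
      by (auto simp: spiral_weight_spiral shadow_def)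
  next
    fix \<zeta> assume "\<zeta> \<in> (\<Union>j\<in>{j. c < ennreal (2 ^ j)}. shadow \<alpha> (spiral j))"
    then show "\<zeta> \<in> {\<zeta> \<in> unit_circle. c < ?M \<zeta>}"
      by (auto simp: stolz_maximal_def less_SUP_iff shadow_def spiral_weight_spiral intro!: bexI[of _ "spiral _"])
  qed
  show "?M \<in> borel_measurable circle_measure"
    by (rule borel_measurableI_greater)
       (auto simp: level intro!: sets.countable_UN' shadow_measurable)
  fix t :: real assume t: "0 < t"
  \<comment> \<open>The first index whose weight exceeds \<open>t\<close>; only shadows from
    \<open>k\<close> on meet the level set.\<close>
  define k where "k = (LEAST k. t < 2 ^ k)"
  have k: "t < 2 ^ k"
    unfolding k_def using real_arch_pow[of 2 t] by (auto intro: LeastI_ex)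
  have "{\<zeta> \<in> unit_circle. ennreal t < ?M \<zeta>} \<subseteq> (\<Union>i. shadow \<alpha> (spiral (k + i)))"
  proof
    fix \<zeta> assume "\<zeta> \<in> {\<zeta> \<in> unit_circle. ennreal t < ?M \<zeta>}"
    then obtain j where j: "ennreal t < ennreal (2 ^ j)" "\<zeta> \<in> shadow \<alpha> (spiral j)"
      unfolding level by auto
    then have "k \<le> j" unfolding k_def using t by (intro Least_le) (simp add: ennreal_less_iff)
    then show "\<zeta> \<in> (\<Union>i. shadow \<alpha> (spiral (k + i)))"
      using j(2) by (auto intro!: exI[of _ "j - k"])
  qed
  then have "measure circle_measure {\<zeta> \<in> unit_circle. ennreal t < ?M \<zeta>}
      \<le> measure circle_measure (\<Union>i. shadow \<alpha> (spiral (k + i)))"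
    by (intro circle.finite_measure_mono) (auto intro: shadow_measurable)
  also have "\<dots> \<le> (\<Sum>i. 8 * \<alpha> * (1/2) ^ k * (1/2) ^ i)"
  proof -
    have le: "measure circle_measure (shadow \<alpha> (spiral (k + i))) \<le> 8 * \<alpha> * (1/2) ^ k * (1/2) ^ i" for i
      using measure_shadow_le[OF assms spiral_in_disc[of "k + i"]]
      by (simp add: cmod_spiral power_add mult_ac)
    have sum: "summable (\<lambda>i. 8 * \<alpha> * (1/2) ^ k * (1/2) ^ i)"
      by (intro summable_mult summable_geometric) simp
    then have sum': "summable (\<lambda>i. measure circle_measure (shadow \<alpha> (spiral (k + i))))"
      by (rule summable_comparison_test'[where N = 0]) (use le in simp)
    show ?thesis
      using shadow_measurable
      by (intro order_trans[OF circle.finite_measure_subadditive_countably[OF _ sum'] suminf_le[OF le sum' sum]])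
        auto
  qed
  also have "\<dots> = 16 * \<alpha> / 2 ^ k"
  proof -
    have "(\<lambda>i. 8 * \<alpha> * (1/2) ^ k * (1/2) ^ i) sums (8 * \<alpha> * (1/2) ^ k * (1 / (1 - 1/2)))"
      by (intro sums_mult geometric_sums) simp
    then show ?thesis by (simp add: sums_iff power_one_over)
  qed
  finally have "t * measure circle_measure {\<zeta> \<in> unit_circle. ennreal t < ?M \<zeta>} \<le> t * (16 * \<alpha> / 2 ^ k)"
    using t by (intro mult_left_mono) auto
  also have "\<dots> \<le> 2 ^ k * (16 * \<alpha> / 2 ^ k)"
    using k assms by (intro mult_right_mono) auto
  finally show "t * measure circle_measure {\<zeta> \<in> unit_circle. ennreal t < ?M \<zeta>} \<le> 16 * \<alpha>"
    by simp
qed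

text \<open>An arc of length at most \<open>2 * \<epsilon>\<close> starting at
  \<open>\<zeta>\<close> contains a piece of length \<open>d = (1/2) ^ j\<close> of the shadow of
  some \<open>spiral j\<close>. The weight \<open>2 ^ j\<close> cancels \<open>d\<close>, leaving
  \<open>1 / (2 * \<epsilon>)\<close>.\<close>

lemma hl_stolz_maximal_spiral_weight_ge:
  assumes "\<alpha> \<ge> 1" "\<zeta> \<in> unit_circle" "0 < \<epsilon>" "\<epsilon> \<le> 1"
  shows "ennreal (1 / (2 * \<epsilon>)) \<le> hl_stolz_maximal \<alpha> spiral_weight \<zeta>"
proof -
  \<comment> \<open>For arguments this large,
    \<open>y\<^sup>2 + 1 \<le> (y + \<epsilon>)\<^sup>2\<close>, so the first integer
    \<open>j \<ge> y\<^sup>2\<close> has its square root in [y, y + \<epsilon>].\<close>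
  obtain y where y: "\<zeta> = cis y" "1 / \<epsilon> \<le> y"
    using assms(2) by (rule unit_circle_cis_near)
  define j where "j = nat \<lceil>y\<^sup>2\<rceil>"
  have y1: "1 \<le> 1 / \<epsilon>" using assms by simp
  have j: "y\<^sup>2 \<le> real j" "real j < y\<^sup>2 + 1"
    unfolding j_def by (auto simp: real_nat_ceiling_ge) linarith
  have sqrt_ge: "y \<le> sqrt (real j)" by (rule real_le_rsqrt[OF j(1)])
  have "1 \<le> y * \<epsilon>" using y(2) assms(3) by (simp add: field_simps)
  then have "y\<^sup>2 + 1 \<le> (y + \<epsilon>)\<^sup>2" by (simp add: power2_sum) (use zero_le_power2[of \<epsilon>] in linarith)
  then have sqrt_le: "sqrt (real j) \<le> y + \<epsilon>"
    using j(2) order_trans[OF y1 y(2)] assms(3) by (intro real_le_lsqrt) auto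
  define d :: real where "d = (1/2) ^ j"
  have d: "0 < d" "d \<le> 1" by (simp_all add: d_def power_le_one)
  \<comment> \<open>The index is also large enough for \<open>2 ^ j\<close> to dominate
    \<open>1 / \<epsilon>\<close>.\<close>
  have "1 / \<epsilon> \<le> y * 1" using y by simp
  also have "\<dots> \<le> y * y" using y y1 by (intro mult_left_mono) auto
  also have "\<dots> \<le> real j" using j(1) by (simp add: power2_eq_square)
  also have "\<dots> \<le> 2 ^ j" using less_exp[of j] by (metis less_imp_le of_nat_le_numeral_power_cancel_iff)
  finally have d_le: "d \<le> \<epsilon>"
    using assms(3) by (simp add: d_def power_divide field_simps)
  \<comment> \<open>The arc runs from \<open>\<zeta>\<close> to angle \<open>d\<close> past the
    spiral point, covering the half of its guaranteed shadow that lies beyond it.\<close>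
  define l where "l = sqrt (real j) - y + d"
  have l: "0 < l" "l \<le> 2 * \<epsilon>" "l < 2 * pi"
    using d sqrt_ge sqrt_le d_le assms(4) pi_gt3 by (auto simp: l_def)
  let ?S = "shadow \<alpha> (spiral j)" and ?J = "cis ` {y..y + l}" and ?m = "measure circle_measure"
  have J: "circle_arc ?J" using l by (intro circle_arc_closed) auto
  have SJ: "?S \<inter> ?J \<in> sets circle_measure"
    using shadow_measurable circle_arc_measurable[OF J] by auto
  have "d / (2 * pi) \<le> ?m (?S \<inter> ?J)"
  proof (rule measure_circle_measure_ge[OF SJ, where a = "sqrt (real j)"])
    fix x assume x: "sqrt (real j) < x" "x < sqrt (real j) + d"
    have "cis x \<in> ?S"
      unfolding spiral_def using assms(1) d x by (intro cis_in_shadow) (auto simp: d_def power_le_one)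
    moreover have "x \<in> {y..y + l}" using x sqrt_ge by (auto simp: l_def)
    ultimately show "cis x \<in> ?S \<inter> ?J" by blast
  qed (use d pi_gt3 in auto)
  moreover have "?m ?J \<le> 2 * \<epsilon> / (2 * pi)"
    using measure_circle_arc_le[OF l(1,3), of y] l(2) divide_right_mono[OF l(2), of "2 * pi"] by auto
  moreover have "l / (2 * pi) \<le> ?m ?J"
    using l by (intro measure_circle_measure_ge[where a = y] circle_arc_measurable J) auto
  moreover have "0 < l / (2 * pi)" using l by simp
  ultimately have "(d / (2 * pi)) / (2 * \<epsilon> / (2 * pi)) \<le> ?m (?S \<inter> ?J) / ?m ?J"
    using d assms(3) by (intro frac_le) auto
  then have "2 ^ j * (d / (2 * \<epsilon>)) \<le> 2 ^ j * (?m (?S \<inter> ?J) / ?m ?J)"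
    by (intro mult_left_mono) auto
  moreover have "2 ^ j * (d / (2 * \<epsilon>)) = 1 / (2 * \<epsilon>)"
    by (simp add: d_def power_divide)
  ultimately have "ennreal (1 / (2 * \<epsilon>)) \<le> ennreal (spiral_weight (spiral j) * (?m (?S \<inter> ?J) / ?m ?J))"
    by (intro ennreal_leI) (simp only: spiral_weight_spiral)
  also have "\<dots> \<le> hl_stolz_maximal \<alpha> spiral_weight \<zeta>"
  proof (subst hl_stolz_maximal_eq)
    have "?J \<in> {I. circle_arc I \<and> \<zeta> \<in> I}" using J y(1) l(1) by auto
    then show "ennreal (spiral_weight (spiral j) * (?m (?S \<inter> ?J) / ?m ?J)) \<le> (SUP z\<in>unit_disc.
        SUP I \<in> {I. circle_arc I \<and> \<zeta> \<in> I}. ennreal (spiral_weight z * (?m (shadow \<alpha> z \<inter> I) / ?m I)))"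
      by (intro SUP_upper2[OF spiral_in_disc[of j]] SUP_upper2[of ?J]) auto
  qed (rule spiral_weight_nonneg)
  finally show ?thesis .
qed

text \<open>Every level set is the whole circle, of measure 1, so the weak norm is at least every
  \<open>t \<ge> 1\<close>.\<close>

lemma hl_stolz_maximal_spiral_weight_not_weak_L1:
  assumes "\<alpha> \<ge> 1"
  shows "hl_stolz_maximal \<alpha> spiral_weight \<notin> weak_L1"
proof
  let ?H = "hl_stolz_maximal \<alpha> spiral_weight"
  let ?N = "SUP t \<in> {0::real<..}. ennreal t * emeasure circle_measure {\<zeta> \<in> unit_circle. ?H \<zeta> > ennreal t}"
  assume "?H \<in> weak_L1"
  then have fin: "?N < \<infinity>" by (simp add: weak_L1_def)
  have ge: "ennreal t \<le> ?N" if t: "1 \<le> t" for t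
  proof -
    have "ennreal t < ?H \<zeta>" if "\<zeta> \<in> unit_circle" for \<zeta>
    proof -
      \<comment> \<open>Taking \<open>\<epsilon> = 1 / (4 * t)\<close> gives the lower bound
        \<open>2 * t\<close>, strictly above \<open>t\<close>; \<open>t \<ge> 1\<close> ensures
        \<open>\<epsilon> \<le> 1\<close>.\<close>
      have "ennreal t < ennreal (1 / (2 * (1 / (4 * t))))"
        using t by (intro ennreal_lessI) auto
      also have "\<dots> \<le> ?H \<zeta>"
        using t that assms by (intro hl_stolz_maximal_spiral_weight_ge) auto
      finally show ?thesis .
    qed
    then have "{\<zeta> \<in> unit_circle. ?H \<zeta> > ennreal t} = space circle_measure" by auto
    then have "ennreal t = ennreal t * emeasure circle_measure {\<zeta> \<in> unit_circle. ?H \<zeta> > ennreal t}"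
      by (simp only: circle.emeasure_space_1 mult_1_right)
    also have "\<dots> \<le> ?N" using t by (intro SUP_upper) auto
    finally show ?thesis .
  qed
  obtain b where b: "?N = ennreal b" "0 \<le> b" using fin by (cases ?N) auto
  have "ennreal (b + 1) \<le> ennreal b" using ge[of "b + 1"] b by simp
  then show False using b(2) by simp
qed

theorem proposition7p4:
  fixes \<alpha> :: real
  assumes "\<alpha> \<ge> 1"
  shows "(\<exists>\<phi> :: complex \<Rightarrow> real. nonneg_borel_on_disc \<phi> \<and>
            hl_stolz_maximal \<alpha> \<phi> \<in> weak_L1 \<and>
            \<not> (\<exists>h. positive_harmonic_majorant h \<phi>))
       \<and> (\<exists>\<phi> :: complex \<Rightarrow> real. nonneg_borel_on_disc \<phi> \<and>
            stolz_maximal \<alpha> \<phi> \<in> weak_L1 \<and>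
            hl_stolz_maximal \<alpha> \<phi> \<notin> weak_L1)"
proof (intro conjI exI)
  show "nonneg_borel_on_disc (\<lambda>z. 1 / cmod (z - 1))"
    unfolding nonneg_borel_on_disc_def by (auto intro!: measurable_restrict_space1)
  show "hl_stolz_maximal \<alpha> (\<lambda>z. 1 / cmod (z - 1)) \<in> weak_L1"
    using assms by (intro hl_stolz_maximal_inverse_dist_weak_L1) simp
  show "\<not> (\<exists>h. positive_harmonic_majorant h (\<lambda>z. 1 / cmod (z - 1)))"
    using no_harmonic_majorant_inverse_dist by blast
  show "nonneg_borel_on_disc spiral_weight"
    unfolding nonneg_borel_on_disc_def
    using measurable_restrict_space1[OF spiral_weight_borel] spiral_weight_nonneg by blast
  show "stolz_maximal \<alpha> spiral_weight \<in> weak_L1"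
    using assms by (intro stolz_maximal_spiral_weight) simp
  show "hl_stolz_maximal \<alpha> spiral_weight \<notin> weak_L1"
    using assms by (rule hl_stolz_maximal_spiral_weight_not_weak_L1)
qed

end
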